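(* For every integer $n\ge3$, $$H(n+1)>H(n).$$
   Context: $p(n)$ denotes the number of (unrestricted) partitions of the positive integer $n$, and $H(n):=p(n)-n$. *)

theory Defs
  imports "HOL-Library.Multiset"
begin

definition partitions_of :: "nat \<Rightarrow> nat multiset set" where
  "partitions_of n = {P. 0 \<notin># P \<and> sum_mset P = n}"

definition p :: "nat \<Rightarrow> nat" where
  "p n = card (partitions_of n)"

(* Integer-valued, so that the subtraction is not truncated. *)
definition H :: "nat \<Rightarrow> int" where
  "H n = int (p n) - int n"

(* card is 0 on infinite sets, so finiteness is what makes p the number of partitions. *)
lemma finite_partitions_of: "finite (partitions_of n)"
proof (rule finite_subset)
  show "partitions_of n \<subseteq> mset ` {xs. set xs \<subseteq> {..n} \<and> length xs \<le> n}"
  proof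
    fix P assume P: "P \<in> partitions_of n"
    obtain xs where xs: "mset xs = P" using ex_mset by blast
    have sum: "sum_list xs = n" and pos: "0 \<notin> set xs"
      using P by (auto simp: partitions_of_def simp flip: xs sum_mset_sum_list)
    have "length xs \<le> sum_list xs"
      using pos by (induction xs) auto
    moreover have "set xs \<subseteq> {..n}"
      using member_le_sum_list sum by fastforce
    ultimately show "P \<in> mset ` {xs. set xs \<subseteq> {..n} \<and> length xs \<le> n}"
      using xs sum by blast
  qed
  show "finite (mset ` {xs. set xs \<subseteq> {..n} \<and> length xs \<le> n})"
    using finite_lists_length_le[of "{..n}" n] by simp
qed

end

(* Adjoining a part 1 embeds the partitions of n into those of n + 1. For n \<ge> 3 its image
   misses the two partitions n + 1 and 2 + (n - 1), which have no part 1. *)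
theory Submission imports Defs begin

text \<open>From \<open>n\<close> to \<open>n + 1\<close> the subtracted term of \<open>H\<close>
  grows by only 1, so strict growth of \<open>H\<close> needs \<open>p\<close> to grow by at least
  2. The two partitions without a part 1 supply exactly this surplus in
  \<open>p_add_2_le_p_Suc\<close>.\<close>

lemma p_add_2_le_p_Suc:
  assumes "n \<ge> 3"
  shows "p n + 2 \<le> p (Suc n)"
proof -
  let ?A = "add_mset 1 ` partitions_of n"
  let ?B = "{{#Suc n#}, {#2, n - 1#}}"
  have "?A \<union> ?B \<subseteq> partitions_of (Suc n)"
    using assms by (auto simp: partitions_of_def)
  hence "card (?A \<union> ?B) \<le> p (Suc n)"
    unfolding p_def by (rule card_mono[OF finite_partitions_of])
  moreover have "card (?A \<union> ?B) = card ?A + card ?B"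
  proof (rule card_Un_disjoint)
    have "\<forall>P\<in>?A. 1 \<in># P"
      by simp
    \<comment> \<open>The bound 3 is sharp here: for \<open>n = 2\<close> the part
      \<open>n - 1\<close> would itself be 1.\<close>
    moreover have "\<forall>P\<in>?B. 1 \<notin># P"
      using assms by simp
    ultimately show "?A \<inter> ?B = {}"
      by blast
  qed (simp_all add: finite_partitions_of)
  moreover have "card ?A = p n"
    unfolding p_def by (rule card_image) (simp add: inj_on_def)
  \<comment> \<open>The two multisets are distinct, having one part and two parts.\<close>
  moreover have "card ?B = 2"
    by simp
  ultimately show ?thesis
    by linarith
qed

theorem theorem3p2:
  fixes n :: nat
  assumes "n \<ge> 3"
  shows "H (n + 1) > H n"
  using p_add_2_le_p_Suc[OF assms] by (simp add: H_def)

end
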